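(* Let $n\ge 1$, let $t\ge 2$ be an even integer, and let $g\in\mathbb{R}[x_1,\ldots,x_n]$ be a nonnegative homogeneous polynomial of degree $t$. Let $\mathbf{B}=[-1,1]^n$ and $\mathbf{K}=\{\mathbf{x}\in\mathbb{R}^n : g(\mathbf{x})\le 1\}$, and assume that $\mathbf{K}\subset\mathbf{B}$ and $\partial\mathbf{K}\subset\{\mathbf{x}: g(\mathbf{x})=1\}$. Let $\lambda$ be the Lebesgue measure on $\mathbf{B}$ normalized to a probability measure, let $\#\lambda$ be the pushforward of $\lambda$ by $g:\mathbf{B}\to\mathbb{R}$, and let $\phi^*$ be the restriction of $\#\lambda$ to $[0,1]$, with mass $\phi^*_0=\phi^*([0,1])=2^{-n}\,\mathrm{vol}(\mathbf{K})$. For every $d\in\mathbb{N}$ let $\mathbf{M}_d(\#\lambda)$ be the $(d+1)\times(d+1)$ Hankel moment matrix of $\#\lambda$, and let $\mathbf{M}^*_d$ be the $(d+1)\times(d+1)$ Hankel matrix with entries $$\mathbf{M}^*_d(k,\ell)=\frac{n}{n+(k+\ell-2)\,t},\qquad k,\ell=1,\ldots,d+1.$$ Then $$\phi^*_0\,=\,\lim_{d\to\infty}\lambda_{\min}\bigl(\mathbf{M}_d(\#\lambda),\mathbf{M}^*_d\bigr).$$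
   Context: $\mathrm{vol}$ denotes (unnormalized) $n$-dimensional Lebesgue measure. The pushforward of $\lambda$ by $g$ is the Borel measure $\#\lambda(C)=\lambda(\{\mathbf{x}\in\mathbf{B}: g(\mathbf{x})\in C\})$ on $\mathbb{R}$. Its moments are $\#\lambda_k=\int z^k\,\#\lambda(dz)=\int_{\mathbf{B}} g(\mathbf{x})^k\,\lambda(d\mathbf{x})$, $k=0,1,\ldots$. The measure $\phi^*$ is defined by $\phi^*(C)=\#\lambda(C\cap[0,1])$ for all Borel $C\subset\mathbb{R}$. The moment matrix $\mathbf{M}_d(\#\lambda)$ has entries $\mathbf{M}_d(\#\lambda)(k,\ell)=\#\lambda_{k+\ell-2}$, $k,\ell=1,\ldots,d+1$. For real symmetric matrices $\mathbf{A},\mathbf{C}$ of the same size, $\lambda_{\min}(\mathbf{A},\mathbf{C})$ denotes the smallest generalized eigenvalue of the pair $(\mathbf{A},\mathbf{C})$, i.e. the smallest scalar $\theta$ such that $\mathbf{A}\mathbf{v}=\theta\,\mathbf{C}\mathbf{v}$ for some nonzero vector $\mathbf{v}$. *)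

theory Defs
  imports
    "HOL-Analysis.Analysis"
    "HOL-Library.Poly_Mapping"
    "Jordan_Normal_Form.Matrix"
begin

text \<open>
  Real polynomials in the variables indexed by the finite type \<open>'n\<close>, as elements of the monoid
  algebra over exponent vectors.
\<close>

type_synonym 'n rpoly = "('n \<Rightarrow>\<^sub>0 nat) \<Rightarrow>\<^sub>0 real"

definition poly_eval :: "'n::finite rpoly \<Rightarrow> real ^ 'n \<Rightarrow> real" where
  "poly_eval p x =
    (\<Sum>m\<in>Poly_Mapping.keys p. Poly_Mapping.lookup p m * (\<Prod>i\<in>UNIV. vec_nth x i ^ Poly_Mapping.lookup m i))"

text \<open>As usual, the zero polynomial is homogeneous of every degree.\<close>

definition homogeneous_of_degree :: "nat \<Rightarrow> 'n::finite rpoly \<Rightarrow> bool" where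
  "homogeneous_of_degree t p \<longleftrightarrow>
    (\<forall>m\<in>Poly_Mapping.keys p. (\<Sum>i\<in>UNIV. Poly_Mapping.lookup m i) = t)"

definition box_B :: "(real ^ 'n::finite) set" where
  "box_B = {x. \<forall>i. vec_nth x i \<in> {-1..1}}"

definition sublevel_K :: "'n::finite rpoly \<Rightarrow> (real ^ 'n) set" where
  "sublevel_K g = {x. poly_eval g x \<le> 1}"

text \<open>
  The measure lives on all of \<open>\<real>\<^sup>n\<close> and vanishes off the box, so its pushforward
  below agrees with the pushforward along the restriction of \<open>g\<close> to the box.
\<close>

definition unif_B :: "(real ^ 'n::finite) measure" where
  "unif_B = uniform_measure lborel box_B"

definition push :: "'n::finite rpoly \<Rightarrow> real measure" where
  "push g = distr unif_B borel (poly_eval g)"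

definition moment :: "real measure \<Rightarrow> nat \<Rightarrow> real" where
  "moment \<mu> k = (\<integral>z. z ^ k \<partial>\<mu>)"

definition phi_star :: "'n::finite rpoly \<Rightarrow> real measure" where
  "phi_star g = density (push g) (indicator {0..1})"

lemma emeasure_phi_star:
  assumes "C \<in> sets borel"
  shows "emeasure (phi_star g) C = emeasure (push g) (C \<inter> {0..1})"
proof -
  have "C \<in> sets (push g)" "{0..1} \<in> sets (push g)"
    using assms by (simp_all add: push_def)
  then show ?thesis
    unfolding phi_star_def
    by (subst emeasure_density)
      (auto simp: indicator_inter_arith[symmetric] Int_commute nn_integral_indicator)
qed

text \<open>
  Matrix indices start at 0, so the entry \<open>k + \<ell> - 2\<close> of the 1-based convention is \<open>i + j\<close>.
\<close>

definition moment_matrix :: "nat \<Rightarrow> real measure \<Rightarrow> real mat" where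
  "moment_matrix d \<mu> = mat (d + 1) (d + 1) (\<lambda>(i, j). moment \<mu> (i + j))"

definition M_star :: "nat \<Rightarrow> nat \<Rightarrow> nat \<Rightarrow> real mat" where
  "M_star n t d = mat (d + 1) (d + 1) (\<lambda>(i, j). real n / (real n + real (i + j) * real t))"

definition gen_eigenvalue :: "real mat \<Rightarrow> real mat \<Rightarrow> real \<Rightarrow> bool" where
  "gen_eigenvalue A C \<theta> \<longleftrightarrow>
    (\<exists>v. v \<in> carrier_vec (dim_col A) \<and> v \<noteq> 0\<^sub>v (dim_col A) \<and>
         A *\<^sub>v v = \<theta> \<cdot>\<^sub>v (C *\<^sub>v v))"

definition lambda_min :: "real mat \<Rightarrow> real mat \<Rightarrow> real" where
  "lambda_min A C = (LEAST \<theta>. gen_eigenvalue A C \<theta>)"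

end

theory Submission
  imports Defs "HOL-Probability.Probability"
begin

text \<open>
  Homogeneity gives \<open>vol {g \<le> s} = s\<^bsup>n/t\<^esup> vol K\<close>, so on \<open>[0,1]\<close> the pushforward is \<open>\<phi>\<^sub>0\<close> times the
  probability measure \<open>\<nu>\<close> with density \<open>(n/t) s\<^bsup>n/t-1\<^esup>\<close>, whose moments are the entries of \<open>M\<^sup>*\<close>.
  The generalized eigenvalue is therefore the minimum of \<open>\<integral>p\<^sup>2 d#\<lambda> / \<integral>p\<^sup>2 d\<nu>\<close> over polynomials \<open>p \<noteq> 0\<close>
  of degree at most \<open>d\<close>. It is at least \<open>\<phi>\<^sub>0\<close> because \<open>#\<lambda> \<ge> \<phi>\<^sub>0 \<nu>\<close>. If \<open>g \<le> M\<close> on the box, the test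
  polynomial \<open>(1 - z/M)\<^sup>d\<close> is exponentially smaller on \<open>(1,M]\<close> than on \<open>[0,1/2]\<close>, which yields
  an upper bound converging to \<open>\<phi>\<^sub>0\<close>.
\<close>

unbundle no inner_syntax and no vec_syntax

subsection \<open>Generalized eigenvalues as Rayleigh quotients\<close>

lemma quadratic_form_vec:
  fixes A :: "real mat"
  assumes "A \<in> carrier_mat n n"
  shows "vec n f \<bullet> (A *\<^sub>v vec n f) = (\<Sum>i<n. \<Sum>j<n. A $$ (i, j) * (f i * f j))"
  using assms
  by (auto simp: scalar_prod_def lessThan_atLeast0 sum_distrib_left mult_ac intro!: sum.cong)

text \<open>The unit sphere of real n-space is coded by functions vanishing from \<open>n\<close>
  on, so that Tychonoff gives compactness: it is a closed subset of a product with factors [-1,1]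
  below \<open>n\<close> and {0} beyond.\<close>

lemma compact_sphere_fun:
  "compact {f :: nat \<Rightarrow> real. (\<forall>i\<ge>n. f i = 0) \<and> (\<Sum>i<n. (f i)\<^sup>2) = 1}" (is "compact ?S")
proof -
  define K where "K i = (if i < n then {-1..1} else {0::real})" for i
  have "compactin (product_topology (\<lambda>i. euclidean) UNIV) (PiE UNIV K)"
    by (subst compactin_PiE) (auto simp: K_def)
  then have K: "compact (PiE UNIV K)"
    by (simp add: euclidean_product_topology)
  have "?S \<subseteq> PiE UNIV K"
  proof (clarsimp simp: PiE_def K_def, intro conjI)
    fix f :: "nat \<Rightarrow> real" and i
    assume f: "(\<Sum>i<n. (f i)\<^sup>2) = 1" and i: "i < n"
    have "(f i)\<^sup>2 \<le> (\<Sum>i<n. (f i)\<^sup>2)"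
      using i by (intro member_le_sum) auto
    then have "\<bar>f i\<bar> \<le> 1"
      using f by (simp add: abs_square_le_1)
    then show "- 1 \<le> f i" "f i \<le> 1" by auto
  qed
  moreover have "closed ?S"
  proof -
    have "?S = (\<Inter>i\<in>{n..}. {f. f i = 0}) \<inter> {f. (\<Sum>i<n. (f i)\<^sup>2) = 1}" by auto
    moreover have "closed \<dots>"
      by (intro closed_Int closed_INT ballI closed_Collect_eq continuous_on_sum continuous_on_power
          continuous_on_const continuous_on_product_coordinates)
    ultimately show ?thesis by simp
  qed
  ultimately show ?thesis
    using compact_Int_closed[OF K, of ?S] by (simp add: Int_absorb1)
qed

text \<open>The Rayleigh quotient attains its minimum on the compact unit sphere. A minimizer is a
  generalized eigenvector by the first-order condition, and every generalized eigenvalue is the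
  quotient at its own eigenvector, hence no smaller. In particular the \<open>LEAST\<close> in
  \<open>lambda_min\<close> is attained.\<close>

lemma lambda_min_rayleigh:
  fixes A C :: "real mat"
  assumes A: "A \<in> carrier_mat n n" and C: "C \<in> carrier_mat n n" and n: "n > 0"
    and symA: "transpose_mat A = A" and symC: "transpose_mat C = C"
    and pos: "\<And>v. v \<in> carrier_vec n \<Longrightarrow> v \<noteq> 0\<^sub>v n \<Longrightarrow> v \<bullet> (C *\<^sub>v v) > 0"
  obtains v where "v \<in> carrier_vec n" "v \<noteq> 0\<^sub>v n"
      "v \<bullet> (A *\<^sub>v v) = lambda_min A C * (v \<bullet> (C *\<^sub>v v))"
      "\<And>w. w \<in> carrier_vec n \<Longrightarrow> lambda_min A C * (w \<bullet> (C *\<^sub>v w)) \<le> w \<bullet> (A *\<^sub>v w)"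
proof -
  define S where "S = {f :: nat \<Rightarrow> real. (\<forall>i\<ge>n. f i = 0) \<and> (\<Sum>i<n. (f i)\<^sup>2) = 1}"
  have nz: "vec n f \<noteq> 0\<^sub>v n" if "f \<in> S" for f
  proof
    assume "vec n f = 0\<^sub>v n"
    then have "f i = 0" if "i < n" for i
      using that by (metis index_vec index_zero_vec(1))
    then have "(\<Sum>i<n. (f i)\<^sup>2) = 0" by simp
    then show False using \<open>f \<in> S\<close> by (simp add: S_def)
  qed
  define R where "R f = (vec n f \<bullet> (A *\<^sub>v vec n f)) / (vec n f \<bullet> (C *\<^sub>v vec n f))" for f
  have coord: "continuous_on S (\<lambda>f. f i)" for i
    by (rule continuous_on_subset[OF continuous_on_product_coordinates]) simp
  have "continuous_on S R"
    unfolding R_def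
  proof (rule continuous_on_divide)
    show "continuous_on S (\<lambda>f. vec n f \<bullet> (A *\<^sub>v vec n f))"
      "continuous_on S (\<lambda>f. vec n f \<bullet> (C *\<^sub>v vec n f))"
      unfolding quadratic_form_vec[OF A] quadratic_form_vec[OF C]
      by (intro continuous_intros coord)+
    show "\<forall>f\<in>S. vec n f \<bullet> (C *\<^sub>v vec n f) \<noteq> 0"
      using pos nz by (metis less_irrefl vec_carrier)
  qed
  moreover have "(\<lambda>i. if i = 0 then 1 else 0) \<in> S"
    using n by (auto simp: S_def if_distrib[of "\<lambda>x. x\<^sup>2"] cong: if_cong)
  then have "S \<noteq> {}" by blast
  moreover have "compact S" unfolding S_def by (rule compact_sphere_fun)
  ultimately obtain f where f: "f \<in> S" and min: "\<And>h. h \<in> S \<Longrightarrow> R f \<le> R h"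
    using continuous_attains_inf[of S R] by blast
  define v where "v = vec n f"
  define \<theta> where "\<theta> = R f"
  have v: "v \<in> carrier_vec n" "v \<noteq> 0\<^sub>v n" using nz[OF f] by (auto simp: v_def)
  have eq: "v \<bullet> (A *\<^sub>v v) = \<theta> * (v \<bullet> (C *\<^sub>v v))"
    using pos[OF v] by (simp add: \<theta>_def R_def v_def)
  have le: "\<theta> * (w \<bullet> (C *\<^sub>v w)) \<le> w \<bullet> (A *\<^sub>v w)" if w: "w \<in> carrier_vec n" for w
  proof (cases "w = 0\<^sub>v n")
    case True
    then show ?thesis using A C by simp
  next
    case False
    then obtain k where k: "k < n" "w $ k \<noteq> 0"
      using w by (metis carrier_vecD eq_vecI index_zero_vec)
    \<comment> \<open>Minimality is known only on the sphere. Writing \<open>w\<close> as its norm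
      \<open>r\<close> times a point of the sphere multiplies both quadratic forms by
      \<open>r * r\<close>.\<close>
    define r where "r = sqrt (\<Sum>i<n. (w $ i)\<^sup>2)"
    have "(w $ k)\<^sup>2 \<le> (\<Sum>i<n. (w $ i)\<^sup>2)"
      using k by (intro member_le_sum) auto
    with k have r0: "r > 0" unfolding r_def
      by (smt (verit) real_sqrt_gt_zero zero_less_power2)
    have r2: "r\<^sup>2 = (\<Sum>i<n. (w $ i)\<^sup>2)" by (simp add: r_def sum_nonneg)
    define h where "h i = (if i < n then w $ i / r else 0)" for i
    have hS: "h \<in> S" using r0
      by (auto simp: S_def h_def power_divide sum_divide_distrib[symmetric] r2[symmetric])
    have w_eq: "w = r \<cdot>\<^sub>v vec n h" using w r0 by (intro eq_vecI) (auto simp: h_def)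
    have "\<theta> \<le> R h" using min[OF hS] by (simp add: \<theta>_def)
    then have "\<theta> * (vec n h \<bullet> (C *\<^sub>v vec n h)) \<le> vec n h \<bullet> (A *\<^sub>v vec n h)"
      using pos[of "vec n h"] nz[OF hS] by (simp add: R_def pos_le_divide_eq)
    then have "r * r * (\<theta> * (vec n h \<bullet> (C *\<^sub>v vec n h))) \<le> r * r * (vec n h \<bullet> (A *\<^sub>v vec n h))"
      using r0 by (intro mult_left_mono) auto
    then show ?thesis
      unfolding w_eq using A C
      by (simp add: mult_mat_vec scalar_prod_smult_distrib[of _ n] smult_scalar_prod_distrib[of _ n] mult_ac)
  qed
  \<comment> \<open>The form \<open>A - \<theta>C\<close> is positive semidefinite and vanishes at \<open>v\<close>; expanding it at \<open>v + s u\<close>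
    forces \<open>u = 0\<close>.\<close>
  define u where "u = A *\<^sub>v v - \<theta> \<cdot>\<^sub>v (C *\<^sub>v v)"
  have u: "u \<in> carrier_vec n" using A C v by (simp add: u_def)
  have comm: "w \<bullet> (M *\<^sub>v z) = z \<bullet> (M *\<^sub>v w)"
    if "M \<in> carrier_mat n n" "transpose_mat M = M" "w \<in> carrier_vec n" "z \<in> carrier_vec n"
    for M :: "real mat" and w z
    using transpose_vec_mult_scalar[OF that(1,4,3)] comm_scalar_prod[of z n "M *\<^sub>v w"] that
    by simp
  have exp: "(v + s \<cdot>\<^sub>v u) \<bullet> (M *\<^sub>v (v + s \<cdot>\<^sub>v u))
      = v \<bullet> (M *\<^sub>v v) + 2 * s * (u \<bullet> (M *\<^sub>v v)) + s * s * (u \<bullet> (M *\<^sub>v u))"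
    if M: "M \<in> carrier_mat n n" "transpose_mat M = M" for M :: "real mat" and s
    using M u v comm[OF M u v(1)]
    by (simp add: mult_add_distrib_mat_vec mult_mat_vec
        scalar_prod_add_distrib[of _ n] add_scalar_prod_distrib[of _ n]
        scalar_prod_smult_distrib[of _ n] smult_scalar_prod_distrib[of _ n] algebra_simps)
  define b where "b = u \<bullet> u"
  have b_sum: "b = (\<Sum>i<n. (u $ i)\<^sup>2)"
    using u by (simp add: b_def scalar_prod_def lessThan_atLeast0 power2_eq_square)
  define c where "c = u \<bullet> (A *\<^sub>v u) - \<theta> * (u \<bullet> (C *\<^sub>v u))"
  \<comment> \<open>Only the second factor of \<open>u \<bullet> u\<close> is unfolded, so that
    \<open>b\<close> becomes half the coefficient of \<open>s\<close> in the expansion at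
    \<open>v + s u\<close>.\<close>
  have b_eq: "b = u \<bullet> (A *\<^sub>v v) - \<theta> * (u \<bullet> (C *\<^sub>v v))"
    unfolding b_def by (subst (2) u_def)
      (use A C u v in \<open>simp add: scalar_prod_minus_distrib[of _ n] scalar_prod_smult_distrib[of _ n]\<close>)
  have quad: "0 \<le> 2 * s * b + s * s * c" for s
    using le[of "v + s \<cdot>\<^sub>v u"] u v eq unfolding exp[OF A symA] exp[OF C symC] b_eq c_def
    by (simp add: algebra_simps)
  have c0: "c \<ge> 0" using le[OF u] by (simp add: c_def)
  have b0: "b \<ge> 0" by (simp add: b_sum sum_nonneg)
  have "b = 0"
  proof (rule ccontr)
    assume "b \<noteq> 0"
    \<comment> \<open>At \<open>s = - k\<close> the quadratic equals
      \<open>- (k * k * (c + 2))\<close>, which is negative. The summand 1 keeps the denominator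
      positive when \<open>c = 0\<close>.\<close>
    define k where "k = b / (c + 1)"
    have k: "k > 0" "b = k * (c + 1)" using \<open>b \<noteq> 0\<close> b0 c0 by (auto simp: k_def)
    have "0 \<le> - (k * k * (c + 2))" using quad[of "- k"] unfolding k(2) by (simp add: algebra_simps)
    moreover have "k * k * (c + 2) > 0" using k c0 by simp
    ultimately show False by simp
  qed
  then have u0: "u $ i = 0" if "i < n" for i
    using that by (simp add: b_sum sum_nonneg_eq_0_iff)
  have ev: "A *\<^sub>v v = \<theta> \<cdot>\<^sub>v (C *\<^sub>v v)"
  proof (rule eq_vecI)
    fix i assume "i < dim_vec (\<theta> \<cdot>\<^sub>v (C *\<^sub>v v))"
    then have "i < n" using C by simp
    then show "(A *\<^sub>v v) $ i = (\<theta> \<cdot>\<^sub>v (C *\<^sub>v v)) $ i"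
      using u0[of i] A C by (simp add: u_def del: index_mult_mat_vec)
  qed (use A C in simp)
  have "lambda_min A C = \<theta>"
    unfolding lambda_min_def
  proof (rule Least_equality)
    show "gen_eigenvalue A C \<theta>"
      using v ev A by (auto simp: gen_eigenvalue_def)
    fix y assume "gen_eigenvalue A C y"
    then obtain w where w: "w \<in> carrier_vec n" "w \<noteq> 0\<^sub>v n" "A *\<^sub>v w = y \<cdot>\<^sub>v (C *\<^sub>v w)"
      using A by (auto simp: gen_eigenvalue_def)
    \<comment> \<open>Pairing the eigenvalue equation with \<open>w\<close> exhibits
      \<open>y\<close> as the Rayleigh quotient at \<open>w\<close>.\<close>
    have "\<theta> * (w \<bullet> (C *\<^sub>v w)) \<le> y * (w \<bullet> (C *\<^sub>v w))"
      using le[OF w(1)] w C by (simp add: scalar_prod_smult_distrib[of _ n])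
    then show "\<theta> \<le> y" using pos[OF w(1,2)] by simp
  qed
  with v eq le that show ?thesis by blast
qed

subsection \<open>Moment matrices\<close>

lemma moment_matrix_carrier: "moment_matrix d \<mu> \<in> carrier_mat (Suc d) (Suc d)"
  by (simp add: moment_matrix_def)

lemma transpose_moment_matrix: "transpose_mat (moment_matrix d \<mu>) = moment_matrix d \<mu>"
  by (rule eq_matI) (auto simp: moment_matrix_def add.commute)

lemma square_power_sum:
  fixes f :: "nat \<Rightarrow> real"
  shows "(\<Sum>i<n. f i * z ^ i)\<^sup>2 = (\<Sum>i<n. \<Sum>j<n. z ^ (i + j) * (f i * f j))"
  by (simp add: power2_eq_square sum_product power_add mult_ac)

lemma integrable_square_power_sum:
  fixes \<mu> :: "real measure"
  assumes "\<And>k. integrable \<mu> (\<lambda>z. z ^ k)"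
  shows "integrable \<mu> (\<lambda>z. (\<Sum>i<n. f i * z ^ i)\<^sup>2)"
  unfolding square_power_sum using assms
  by (intro Bochner_Integration.integrable_sum integrable_mult_left)

text \<open>Expanding the square produces the monomials \<open>z ^ (i + j)\<close>, whose integrals
  are the Hankel entries. Rayleigh quotients of moment matrices thus become ratios of integrals of
  squared polynomials.\<close>

lemma moment_matrix_quadratic_form:
  fixes \<mu> :: "real measure"
  assumes "\<And>k. integrable \<mu> (\<lambda>z. z ^ k)"
  shows "vec (Suc d) f \<bullet> (moment_matrix d \<mu> *\<^sub>v vec (Suc d) f)
      = (\<integral>z. (\<Sum>i<Suc d. f i * z ^ i)\<^sup>2 \<partial>\<mu>)"
proof -
  have int: "integrable \<mu> (\<lambda>z. z ^ (i + j) * (f i * f j))" for i j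
    using assms by (intro integrable_mult_left)
  have "(\<integral>z. (\<Sum>i<Suc d. f i * z ^ i)\<^sup>2 \<partial>\<mu>) =
      (\<Sum>i<Suc d. \<Sum>j<Suc d. (\<integral>z. z ^ (i + j) * (f i * f j) \<partial>\<mu>))"
    unfolding square_power_sum
    by (subst Bochner_Integration.integral_sum, intro Bochner_Integration.integrable_sum int,
        rule sum.cong[OF refl], subst Bochner_Integration.integral_sum, rule int, rule refl)
  also have "\<dots> = (\<Sum>i<Suc d. \<Sum>j<Suc d. moment_matrix d \<mu> $$ (i, j) * (f i * f j))"
    by (intro sum.cong refl) (simp add: moment_matrix_def moment_def)
  finally show ?thesis
    unfolding quadratic_form_vec[OF moment_matrix_carrier] by simp
qed

text \<open>A nonzero polynomial has finitely many roots, and these form a null set. Its square is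
  therefore not almost everywhere zero under a nonzero measure, so its integral is positive. This is
  the definiteness that \<open>lambda_min_rayleigh\<close> requires of its second matrix.\<close>

lemma quadratic_form_moment_pos:
  fixes \<nu> :: "real measure"
  assumes int: "\<And>k. integrable \<nu> (\<lambda>z. z ^ k)"
    and fin: "\<And>X. finite X \<Longrightarrow> AE z in \<nu>. z \<notin> X"
    and nz: "emeasure \<nu> (space \<nu>) \<noteq> 0"
    and v: "v \<in> carrier_vec (Suc d)" "v \<noteq> 0\<^sub>v (Suc d)"
  shows "v \<bullet> (moment_matrix d \<nu> *\<^sub>v v) > 0"
proof -
  define f where "f i = v $ i" for i
  have v_eq: "v = vec (Suc d) f" using v(1) by (intro eq_vecI) (auto simp: f_def)
  obtain k where k: "k \<le> d" "f k \<noteq> 0"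
    using v by (metis carrier_vecD eq_vecI f_def index_zero_vec less_Suc_eq_le)
  let ?q = "\<lambda>z. \<Sum>i<Suc d. f i * z ^ i"
  have "finite {z. (\<Sum>i\<le>d. f i * z ^ i) = 0}"
    using k polyfun_rootbound(1) by blast
  then have "AE z in \<nu>. z \<notin> {z. ?q z = 0}"
    by (intro fin) (simp add: lessThan_Suc_atMost)
  moreover have "\<not> (AE z in \<nu>. False)"
    using nz by (auto simp: AE_iff_measurable[OF sets.top])
  ultimately have "\<not> (AE z in \<nu>. (?q z)\<^sup>2 = 0)"
    using eventually_elim2[of "\<lambda>z. z \<notin> {z. ?q z = 0}" "ae_filter \<nu>" "\<lambda>z. (?q z)\<^sup>2 = 0" "\<lambda>_. False"]
    by auto
  then have "(\<integral>z. (?q z)\<^sup>2 \<partial>\<nu>) \<noteq> 0"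
    by (subst integral_nonneg_eq_0_iff_AE) (simp_all add: integrable_square_power_sum[OF int] del: sum.lessThan_Suc)
  moreover have "(\<integral>z. (?q z)\<^sup>2 \<partial>\<nu>) \<ge> 0" by simp
  ultimately show ?thesis
    unfolding v_eq moment_matrix_quadratic_form[OF int] by linarith
qed

section \<open>Test polynomials and the limit of the smallest generalized eigenvalue\<close>

text \<open>The binomial theorem supplies the coefficient vector of the test polynomial, used with
  \<open>a = 1 / M\<close>.\<close>

lemma one_minus_power_sum:
  fixes a :: real
  obtains f where "\<And>z. (\<Sum>i<Suc d. f i * z ^ i) = (1 - z * a) ^ d"
proof
  fix z
  have "(1 - z * a) ^ d = ((- a * z) + 1) ^ d" by (simp add: mult_ac)
  also have "\<dots> = (\<Sum>i\<le>d. (of_nat (d choose i) * (- a) ^ i) * z ^ i)"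
    unfolding binomial_ring power_mult_distrib by (simp add: mult_ac)
  finally show "(\<Sum>i<Suc d. (of_nat (d choose i) * (- a) ^ i) * z ^ i) = (1 - z * a) ^ d"
    by (simp add: lessThan_Suc_atMost)
qed

text \<open>The eigenvalue is squeezed between \<open>c\<close> and \<open>c + m * q ^ d\<close>
  with \<open>q < 1\<close>. The lower bound holds because \<mu> equals \<open>c\<close> times \<nu>
  on [0,1] and only adds mass elsewhere; the upper bound is the Rayleigh quotient of a test
  polynomial small on (1,M].\<close>

lemma lambda_min_moment_matrices_tendsto:
  fixes \<mu> \<nu> :: "real measure" and M c :: real
  assumes \<mu>: "finite_measure \<mu>" "sets \<mu> = sets borel" and \<nu>: "finite_measure \<nu>" "sets \<nu> = sets borel"
    and supp: "AE z in \<mu>. z \<in> {0..M}" and M: "M \<ge> 1"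
    and supp_\<nu>: "AE z in \<nu>. z \<in> {0..1}"
    and fin: "\<And>X. finite X \<Longrightarrow> AE z in \<nu>. z \<notin> X"
    and half: "measure \<nu> {0..1/2} > 0"
    and restr: "density \<mu> (indicator {0..1}) = density \<nu> (\<lambda>_. ennreal c)" and c: "c \<ge> 0"
  shows "(\<lambda>d. lambda_min (moment_matrix d \<mu>) (moment_matrix d \<nu>)) \<longlonglongrightarrow> c"
proof -
  interpret \<mu>: finite_measure \<mu> by fact
  interpret \<nu>: finite_measure \<nu> by fact
  note [measurable_cong] = \<mu>(2) \<nu>(2)
  have int_\<mu>: "integrable \<mu> (\<lambda>z. z ^ k)" for k
    by (rule \<mu>.integrable_const_bound[where B = "M ^ k"])
       (rule eventually_mono[OF supp], auto intro: power_mono)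
  have int_\<nu>: "integrable \<nu> (\<lambda>z. z ^ k)" for k
    by (rule \<nu>.integrable_const_bound[where B = 1])
       (rule eventually_mono[OF supp_\<nu>], auto intro: power_le_one)
  define Q where "Q f d z = (\<Sum>i<Suc d. f i * z ^ i :: real)" for f d z
  have Q_meas [measurable]: "Q f d \<in> borel_measurable borel" for f d
    unfolding Q_def by measurable
  have iQ_\<mu>: "integrable \<mu> (\<lambda>z. (Q f d z)\<^sup>2)" and iQ_\<nu>: "integrable \<nu> (\<lambda>z. (Q f d z)\<^sup>2)" for f d
    unfolding Q_def by (intro integrable_square_power_sum int_\<mu> int_\<nu>)+
  \<comment> \<open>By \<open>restr\<close>, the part of the integral over [0,1] is \<open>c\<close>
    times the integral against \<nu>; what remains is the contribution from outside [0,1].\<close>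
  have split: "(\<integral>z. (Q f d z)\<^sup>2 \<partial>\<mu>) = c * (\<integral>z. (Q f d z)\<^sup>2 \<partial>\<nu>)
      + (\<integral>z. indicator (- {0..1}) z * (Q f d z)\<^sup>2 \<partial>\<mu>)"
    for f d
  proof -
    have "c * (\<integral>z. (Q f d z)\<^sup>2 \<partial>\<nu>) = (\<integral>z. (Q f d z)\<^sup>2 \<partial>density \<nu> (\<lambda>_. ennreal c))"
      using c by (subst integral_density) auto
    also have "\<dots> = (\<integral>z. (Q f d z)\<^sup>2 \<partial>density \<mu> (\<lambda>z. ennreal (indicator {0..1} z)))"
      by (simp add: restr[symmetric] ennreal_indicator)
    also have "\<dots> = (\<integral>z. indicator {0..1} z * (Q f d z)\<^sup>2 \<partial>\<mu>)"
      by (subst integral_density) auto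
    finally have eq: "c * (\<integral>z. (Q f d z)\<^sup>2 \<partial>\<nu>) = (\<integral>z. indicator {0..1} z * (Q f d z)\<^sup>2 \<partial>\<mu>)" .
    have int: "integrable \<mu> (\<lambda>z. indicator X z * (Q f d z)\<^sup>2)" if "X \<in> sets borel" for X
      using integrable_mult_indicator[OF _ iQ_\<mu>, of X] that by (simp add: \<mu>(2))
    show ?thesis
      unfolding eq
      by (subst Bochner_Integration.integral_add[symmetric], (rule int, simp)+,
          rule Bochner_Integration.integral_cong) (auto simp: indicator_def)
  qed
  \<comment> \<open>The product \<open>m * q ^ d\<close> is the quotient of an upper bound for the
    test integral outside [0,1] by a lower bound for the test integral over [0,1/2]. For
    \<open>M = 1\<close> the base \<open>q\<close> is 0.\<close>
  define m where "m = measure \<mu> (space \<mu>) / measure \<nu> {0..1/2}"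
  define q where "q = ((1 - 1 / M) / (1 - 1 / (2 * M)))\<^sup>2"
  have M2: "1 - 1 / (2 * M) > 0" "1 - 1 / M \<ge> 0" "1 - 1 / M < 1 - 1 / (2 * M)"
    using M by (auto simp: field_simps)
  have q: "0 \<le> q" "q < 1"
    using M2 by (simp_all add: q_def power_less_one_iff abs_square_less_1)
  let ?L = "\<lambda>d. lambda_min (moment_matrix d \<mu>) (moment_matrix d \<nu>)"
  have nz: "emeasure \<nu> (space \<nu>) \<noteq> 0"
    using half \<nu>.finite_measure_mono[of "{0..1/2}" "space \<nu>"] sets_eq_imp_space_eq[OF \<nu>(2)]
    by (auto simp: \<nu>.emeasure_eq_measure)
  have bounds: "c \<le> ?L d \<and> ?L d \<le> c + m * q ^ d" for d
  proof -
    have pos: "v \<bullet> (moment_matrix d \<nu> *\<^sub>v v) > 0"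
      if "v \<in> carrier_vec (Suc d)" "v \<noteq> 0\<^sub>v (Suc d)" for v
      using quadratic_form_moment_pos[OF int_\<nu> fin nz that] by blast
    obtain v where v: "v \<in> carrier_vec (Suc d)" "v \<noteq> 0\<^sub>v (Suc d)"
      "v \<bullet> (moment_matrix d \<mu> *\<^sub>v v) = ?L d * (v \<bullet> (moment_matrix d \<nu> *\<^sub>v v))"
      and min: "\<And>w. w \<in> carrier_vec (Suc d) \<Longrightarrow>
          ?L d * (w \<bullet> (moment_matrix d \<nu> *\<^sub>v w)) \<le> w \<bullet> (moment_matrix d \<mu> *\<^sub>v w)"
      using lambda_min_rayleigh[OF moment_matrix_carrier moment_matrix_carrier _
          transpose_moment_matrix transpose_moment_matrix pos] by (metis zero_less_Suc)
    define f where "f i = v $ i" for i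
    have v_eq: "v = vec (Suc d) f" using v(1) by (intro eq_vecI) (auto simp: f_def)
    \<comment> \<open>Lower bound: at the minimizer \<open>v\<close> the contribution from outside
      [0,1] is nonnegative.\<close>
    have "(\<integral>z. indicator (- {0..1}) z * (Q f d z)\<^sup>2 \<partial>\<mu>) \<ge> 0"
      by (intro Bochner_Integration.integral_nonneg) simp
    then have "c * (\<integral>z. (Q f d z)\<^sup>2 \<partial>\<nu>) \<le> ?L d * (\<integral>z. (Q f d z)\<^sup>2 \<partial>\<nu>)"
      using v(3) split[of f d] unfolding v_eq moment_matrix_quadratic_form[OF int_\<mu>]
        moment_matrix_quadratic_form[OF int_\<nu>] Q_def[symmetric] by linarith
    moreover have "(\<integral>z. (Q f d z)\<^sup>2 \<partial>\<nu>) > 0"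
      using pos[OF v(1,2)] unfolding v_eq moment_matrix_quadratic_form[OF int_\<nu>] Q_def[symmetric] .
    ultimately have low: "c \<le> ?L d" by simp
    \<comment> \<open>Upper bound: the minimum property is applied to the coefficients of
      \<open>(1 - z / M) ^ d\<close>, which is nonnegative and decreasing on [0,M].\<close>
    obtain h where h: "\<And>z. (\<Sum>i<Suc d. h i * z ^ i) = (1 - z * (1 / M)) ^ d"
      using one_minus_power_sum by blast
    have Qh: "Q h d z = (1 - z / M) ^ d" for z unfolding Q_def h by simp
    define I where "I = (\<integral>z. (Q h d z)\<^sup>2 \<partial>\<nu>)"
    have "?L d * I \<le> c * I + (\<integral>z. indicator (- {0..1}) z * (Q h d z)\<^sup>2 \<partial>\<mu>)"
      using min[of "vec (Suc d) h"] split[of h d] unfolding moment_matrix_quadratic_form[OF int_\<mu>]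
        moment_matrix_quadratic_form[OF int_\<nu>] Q_def[symmetric] I_def by simp
    also have "(\<integral>z. indicator (- {0..1}) z * (Q h d z)\<^sup>2 \<partial>\<mu>) \<le> (\<integral>z. ((1 - 1 / M) ^ d)\<^sup>2 \<partial>\<mu>)"
    proof (rule integral_mono_AE)
      show "integrable \<mu> (\<lambda>z. indicator (- {0..1}) z * (Q h d z)\<^sup>2)"
        using integrable_mult_indicator[OF _ iQ_\<mu>, of "- {0..1}"] by (simp add: \<mu>(2))
      show "AE z in \<mu>. indicator (- {0..1}) z * (Q h d z)\<^sup>2 \<le> ((1 - 1 / M) ^ d)\<^sup>2"
        using supp
      proof (rule eventually_mono)
        fix z assume z: "z \<in> {0..M}"
        show "indicator (- {0..1}) z * (Q h d z)\<^sup>2 \<le> ((1 - 1 / M) ^ d)\<^sup>2"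
        proof (cases "z \<le> 1")
          case False
          have "(1 - z / M) ^ d \<le> (1 - 1 / M) ^ d"
            using M z False by (intro power_mono) (auto simp: divide_right_mono)
          moreover have "(1 - z / M) ^ d \<ge> 0" using M z by simp
          ultimately show ?thesis unfolding Qh using False by (simp add: power_mono)
        qed (use z in simp)
      qed
    qed simp
    also have "\<dots> = measure \<mu> (space \<mu>) * ((1 - 1 / M) ^ d)\<^sup>2" by simp
    finally have up: "?L d * I \<le> c * I + measure \<mu> (space \<mu>) * ((1 - 1 / M) ^ d)\<^sup>2" by simp
    \<comment> \<open>The integral \<open>I\<close> is at least the contribution of [0,1/2], where
      the test polynomial is at least its value at 1/2.\<close>
    have "measure \<nu> {0..1/2} * ((1 - 1 / (2 * M)) ^ d)\<^sup>2
        = (\<integral>z. indicator {0..1/2} z * ((1 - 1 / (2 * M)) ^ d)\<^sup>2 \<partial>\<nu>)"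
      using sets_eq_imp_space_eq[OF \<nu>(2)] by simp
    also have "\<dots> \<le> I"
      unfolding I_def
    proof (rule integral_mono)
      fix z
      show "indicator {0..1/2} z * ((1 - 1 / (2 * M)) ^ d)\<^sup>2 \<le> (Q h d z)\<^sup>2"
      proof (cases "z \<in> {0..1/2}")
        case True
        then have "(1 - 1 / (2 * M)) ^ d \<le> (1 - z / M) ^ d"
          using M M2 by (intro power_mono) (auto simp: field_simps)
        then show ?thesis unfolding Qh using True M2 by (simp add: power_mono)
      qed simp
    qed (auto simp: iQ_\<nu> \<nu>.emeasure_eq_measure \<nu>(2))
    finally have I: "measure \<nu> {0..1/2} * ((1 - 1 / (2 * M)) ^ d)\<^sup>2 \<le> I" .
    then have I0: "I > 0" using half M2 by (smt (verit) mult_pos_pos zero_less_power)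
    \<comment> \<open>By the choice of \<open>m\<close> and \<open>q\<close>, the left side is
      exactly the bound on the remainder in \<open>up\<close>, so that remainder is at most
      \<open>m * q ^ d * I\<close>.\<close>
    have "m * q ^ d * (measure \<nu> {0..1/2} * ((1 - 1 / (2 * M)) ^ d)\<^sup>2) \<le> m * q ^ d * I"
      using I q half by (intro mult_left_mono) (auto simp: m_def)
    moreover have "m * q ^ d * (measure \<nu> {0..1/2} * ((1 - 1 / (2 * M)) ^ d)\<^sup>2)
        = measure \<mu> (space \<mu>) * ((1 - 1 / M) ^ d)\<^sup>2"
      using half M M2 by (simp add: m_def q_def power_divide power_mult[symmetric] mult.commute)
    ultimately have "?L d * I \<le> (c + m * q ^ d) * I"
      using up by (simp add: algebra_simps)
    then show ?thesis using I0 low by simp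
  qed
  have "(\<lambda>d. c + m * q ^ d) \<longlonglongrightarrow> c + m * 0"
    using q by (intro tendsto_intros LIMSEQ_realpow_zero) auto
  then have "(\<lambda>d. c + m * q ^ d) \<longlonglongrightarrow> c" by simp
  then show ?thesis
    by (rule tendsto_sandwich[OF _ _ tendsto_const, rotated 2]) (use bounds in auto)
qed

subsection \<open>Power-law distributions on the unit interval\<close>

text \<open>For \<open>a > 0\<close> this is the Beta(a,1) law, with distribution function
  \<open>s powr a\<close> on [0,1]. For \<open>a = n / t\<close> its moments
  \<open>a / (a + k)\<close> are the entries of \<open>M_star\<close>.\<close>

definition power_law :: "real \<Rightarrow> real measure" where
  "power_law a = density lborel (\<lambda>s. ennreal (a * s powr (a - 1) * indicator {0..1} s))"

lemma sets_power_law [simp, measurable_cong]: "sets (power_law a) = sets borel"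
  by (simp add: power_law_def)

lemma space_power_law [simp]: "space (power_law a) = UNIV"
  by (simp add: power_law_def)

text \<open>One computation serves twice: \<open>k = 0\<close> gives the distribution function and
  total mass, hence the factors \<open>s ^ 0\<close> below, and \<open>c = 1\<close> gives the
  moments.\<close>

lemma nn_integral_powr_moment:
  fixes a c :: real
  assumes a: "a > 0" and c: "c \<ge> 0"
  shows "(\<integral>\<^sup>+s. ennreal (a * s powr (a - 1) * s ^ k) * indicator {0..c} s \<partial>lborel)
      = ennreal (a / (a + k) * c powr (a + k))"
proof (rule nn_integral_has_integral_lebesgue')
  show "0 \<le> a * s powr (a - 1) * s ^ k" if "s \<in> {0..c}" for s
    using a that by simp
  have "((\<lambda>s. a * s powr (a + k - 1)) has_integral (a * (c powr (a + k - 1 + 1) / (a + k - 1 + 1)))) {0..c}"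
    using a c by (intro has_integral_mult_right has_integral_powr_from_0) auto
  then have "((\<lambda>s. a * s powr (a + k - 1)) has_integral (a / (a + k) * c powr (a + k))) {0..c}"
    by simp
  moreover have "a * s powr (a - 1) * s ^ k = a * s powr (a + k - 1)" if "s \<in> {0..c}" for s
  \<comment> \<open>At \<open>s = 0\<close> both sides vanish, since \<open>0 powr x = 0\<close> for
    every exponent, including negative ones and 0.\<close>
  proof (cases "s = 0")
    case False
    then have "s ^ k = s powr k" using that by (simp add: powr_realpow)
    then show ?thesis by (simp add: powr_add[symmetric] algebra_simps)
  qed simp
  ultimately show "((\<lambda>s. a * s powr (a - 1) * s ^ k) has_integral (a / (a + k) * c powr (a + k))) {0..c}"
    using has_integral_cong by (metis (no_types, lifting))
qed

lemma emeasure_power_law_atMost: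
  assumes a: "a > 0"
  shows "emeasure (power_law a) {..x} = (if x < 0 then 0 else ennreal (min x 1 powr a))"
proof -
  have eq: "emeasure (power_law a) {..x} =
      (\<integral>\<^sup>+s. ennreal (a * s powr (a - 1) * s ^ 0) * indicator ({0..1} \<inter> {..x}) s \<partial>lborel)"
    unfolding power_law_def
    by (subst emeasure_density) (auto intro!: nn_integral_cong simp: indicator_def)
  show ?thesis
  proof (cases "x < 0")
    case True
    then have "{0..1} \<inter> {..x} = {}" by auto
    then show ?thesis using eq True by simp
  next
    case False
    have "{0..1} \<inter> {..x} = {0..min x 1}" by auto
    then show ?thesis
      using eq nn_integral_powr_moment[OF a, of "min x 1" 0] False a by simp
  qed
qed

lemma finite_measure_power_law:
  assumes "a > 0"
  shows "finite_measure (power_law a)"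
proof
  have "emeasure (power_law a) (space (power_law a))
      \<le> (\<integral>\<^sup>+s. ennreal (a * s powr (a - 1) * s ^ 0) * indicator {0..1} s \<partial>lborel)"
    unfolding power_law_def
    by (subst emeasure_density) (auto intro!: nn_integral_mono simp: indicator_def)
  also have "\<dots> < \<infinity>"
    by (subst nn_integral_powr_moment[OF assms]) auto
  finally show "emeasure (power_law a) (space (power_law a)) \<noteq> \<infinity>" by simp
qed

lemma AE_power_law_unit_interval: "AE s in power_law a. s \<in> {0..1}"
  unfolding power_law_def by (subst AE_density) (auto simp: indicator_def)

lemma AE_power_law_not_in_finite:
  assumes "finite X"
  shows "AE s in power_law a. s \<notin> X"
proof -
  have "AE s in lborel. s \<notin> X"
    using assms by (intro AE_not_in) (auto simp: null_sets_def finite_imp_closed emeasure_lborel_countable countable_finite)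
  then show ?thesis
    unfolding power_law_def by (subst AE_density) (auto elim: eventually_mono)
qed

lemma moment_power_law:
  assumes a: "a > 0"
  shows "moment (power_law a) k = a / (a + k)"
proof -
  have "has_bochner_integral lborel (\<lambda>s. (a * s powr (a - 1) * indicator {0..1} s) *\<^sub>R s ^ k) (a / (a + k))"
  proof (rule has_bochner_integral_nn_integral)
    have "(\<integral>\<^sup>+s. ennreal ((a * s powr (a - 1) * indicator {0..1} s) *\<^sub>R s ^ k) \<partial>lborel) =
        (\<integral>\<^sup>+s. ennreal (a * s powr (a - 1) * s ^ k) * indicator {0..1} s \<partial>lborel)"
      by (intro nn_integral_cong) (auto simp: indicator_def)
    also have "\<dots> = ennreal (a / (a + k))"
      by (subst nn_integral_powr_moment[OF a]) auto
    finally show "(\<integral>\<^sup>+s. ennreal ((a * s powr (a - 1) * indicator {0..1} s) *\<^sub>R s ^ k) \<partial>lborel)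
        = ennreal (a / (a + k))" .
  qed (use a in \<open>auto simp: indicator_def\<close>)
  then show ?thesis
    unfolding moment_def power_law_def using a
    by (subst integral_density) (auto simp: has_bochner_integral_iff)
qed

subsection \<open>Pushforward of the uniform measure by a homogeneous polynomial\<close>

lemma continuous_on_poly_eval: "continuous_on S (poly_eval g)"
  unfolding poly_eval_def by (intro continuous_intros)

lemma poly_eval_measurable [measurable]: "poly_eval g \<in> borel_measurable borel"
  by (rule borel_measurable_continuous_onI[OF continuous_on_poly_eval])

lemma poly_eval_scaleR:
  assumes "homogeneous_of_degree t g"
  shows "poly_eval g (c *\<^sub>R x) = c ^ t * poly_eval g x"
proof -
  have "(\<Prod>i\<in>UNIV. vec_nth (c *\<^sub>R x) i ^ Poly_Mapping.lookup m i)
      = c ^ t * (\<Prod>i\<in>UNIV. vec_nth x i ^ Poly_Mapping.lookup m i)"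
    if "m \<in> Poly_Mapping.keys g" for m
  proof -
    have "(\<Sum>i\<in>UNIV. Poly_Mapping.lookup m i) = t"
      using assms that by (auto simp: homogeneous_of_degree_def)
    then show ?thesis
      by (simp add: power_mult_distrib prod.distrib power_sum[symmetric])
  qed
  then show ?thesis
    unfolding poly_eval_def sum_distrib_left
    by (intro sum.cong refl) (simp add: mult_ac)
qed

text \<open>The substitution of \<open>r *\<^sub>R x\<close> for \<open>x\<close> contributes the
  Jacobian \<open>r ^ DIM('a)\<close>, and homogeneity cancels \<open>r ^ t\<close> from the
  inequality.\<close>

lemma emeasure_lborel_scaled_sublevel:
  fixes f :: "'a::euclidean_space \<Rightarrow> real"
  assumes [measurable]: "f \<in> borel_measurable borel"
    and hom: "\<And>r x. r > 0 \<Longrightarrow> f (r *\<^sub>R x) = r ^ t * f x"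
    and r: "r > 0"
  shows "emeasure lborel {x. f x \<le> r ^ t * c} = ennreal (r ^ DIM('a)) * emeasure lborel {x. f x \<le> c}"
proof -
  have [measurable]: "{x. f x \<le> b} \<in> sets borel" for b
    by measurable
  have "emeasure lborel {x. f x \<le> r ^ t * c}
      = emeasure (density (distr lborel borel (\<lambda>x. 0 + r *\<^sub>R x)) (\<lambda>_. \<bar>r\<bar> ^ DIM('a))) {x. f x \<le> r ^ t * c}"
    using lborel_affine[of r "0::'a"] r by simp
  also have "\<dots> = ennreal (r ^ DIM('a)) * emeasure lborel {x. f (r *\<^sub>R x) \<le> r ^ t * c}"
    using r by (simp add: emeasure_density_const emeasure_distr vimage_def)
  also have "{x. f (r *\<^sub>R x) \<le> r ^ t * c} = {x. f x \<le> c}"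
    using r hom by simp
  finally show ?thesis .
qed

lemma box_B_eq_cbox: "box_B = cbox (- 1) (1 :: real ^ 'n::finite)"
  by (auto simp: box_B_def mem_box_cart)

lemma emeasure_lborel_box_B: "emeasure lborel (box_B :: (real ^ 'n::finite) set) = ennreal (2 ^ CARD('n))"
proof -
  have "(- 1 :: real ^ 'n) \<in> cbox (- 1) 1" by (simp add: mem_box_cart)
  then have "cbox (- 1) (1 :: real ^ 'n) \<noteq> {}" by blast
  then have "measure lborel (cbox (- 1) (1 :: real ^ 'n)) = 2 ^ CARD('n)"
    by (simp add: content_cbox_cart)
  then show ?thesis
    unfolding box_B_eq_cbox
    by (metis emeasure_eq_ennreal_measure emeasure_lborel_cbox_finite less_irrefl infinity_ennreal_def)
qed

lemma sets_push [simp, measurable_cong]: "sets (push g) = sets borel"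
  by (simp add: push_def)

lemma emeasure_push:
  fixes g :: "'n::finite rpoly"
  assumes "X \<in> sets borel"
  shows "emeasure (push g) X = emeasure lborel (box_B \<inter> poly_eval g -` X) / ennreal (2 ^ CARD('n))"
proof -
  have "poly_eval g -` X \<in> sets borel"
    using measurable_sets_borel[OF poly_eval_measurable assms, of g] by simp
  then show ?thesis
    using assms unfolding push_def unif_B_def
    by (simp add: emeasure_distr emeasure_uniform_measure box_B_eq_cbox emeasure_lborel_box_B[unfolded box_B_eq_cbox])
qed

lemma finite_measure_push: "finite_measure (push (g :: 'n::finite rpoly))"
proof -
  have "prob_space (unif_B :: (real ^ 'n) measure)"
    unfolding unif_B_def by (rule prob_space_uniform_measure) (simp_all add: emeasure_lborel_box_B)
  then have "prob_space (push g)"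
    unfolding push_def by (rule prob_space.prob_space_distr) (simp add: unif_B_def)
  then show ?thesis by (rule prob_space.finite_measure)
qed

text \<open>A continuous function is bounded on the compact box. Taking the maximum with 1 makes
  \<open>1 - 1 / M\<close> nonnegative, as the test polynomial estimate needs.\<close>

lemma AE_push_bounded:
  fixes g :: "'n::finite rpoly"
  assumes "\<forall>x. poly_eval g x \<ge> 0"
  obtains M where "M \<ge> 1" "AE z in push g. z \<in> {0..M}"
proof -
  have "compact (poly_eval g ` (box_B :: (real ^ 'n) set))"
    unfolding box_B_eq_cbox by (intro compact_continuous_image continuous_on_poly_eval compact_cbox)
  then have "bounded (poly_eval g ` (box_B :: (real ^ 'n) set))"
    by (rule compact_imp_bounded)
  then obtain b where b: "\<And>x. x \<in> (box_B :: (real ^ 'n) set) \<Longrightarrow> \<bar>poly_eval g x\<bar> \<le> b"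
    unfolding bounded_iff by auto
  have "AE x in unif_B. x \<in> (box_B :: (real ^ 'n) set)"
    unfolding unif_B_def by (rule AE_uniform_measureI) (simp_all add: box_B_eq_cbox)
  then have "AE x in unif_B. poly_eval g x \<in> {0..max 1 b}"
    by (rule eventually_mono) (use b assms in fastforce)
  then have "AE z in push g. z \<in> {0..max 1 b}"
    unfolding push_def by (subst AE_distr_iff) (auto simp: unif_B_def)
  then show ?thesis using that[of "max 1 b"] by simp
qed

text \<open>Scaling by the t-th root of a level reduces every positive level to level 1, so the
  volume of a sublevel set grows like the power n/t of the level.\<close>

lemma emeasure_phi_star_atMost:
  fixes g :: "'n::finite rpoly"
  assumes t: "t > 0" and hom: "homogeneous_of_degree t g"
    and nonneg: "\<forall>x. poly_eval g x \<ge> 0" and sub: "sublevel_K g \<subseteq> box_B"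
  shows "emeasure (phi_star g) {..x} = (if x < 0 then 0 else
    ennreal (measure lborel (sublevel_K g) / 2 ^ CARD('n) * min x 1 powr (CARD('n) / t)))"
proof -
  define V where "V c = emeasure lborel {x. poly_eval g x \<le> c}" for c
  have K_fin: "emeasure lborel (sublevel_K g) = ennreal (measure lborel (sublevel_K g))"
  proof -
    have "emeasure lborel (sublevel_K g) \<le> emeasure lborel (box_B :: (real ^ 'n) set)"
      using sub by (intro emeasure_mono) (auto simp: box_B_eq_cbox)
    also have "\<dots> < \<infinity>" by (simp add: emeasure_lborel_box_B)
    finally show ?thesis by (intro emeasure_eq_ennreal_measure) simp
  qed
  have V_scale: "V (r ^ t * c) = ennreal (r ^ CARD('n)) * V c" if "r > 0" for r c
    using emeasure_lborel_scaled_sublevel[OF poly_eval_measurable poly_eval_scaleR[OF hom] that]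
    by (simp add: V_def)
  have V_1: "V 1 = ennreal (measure lborel (sublevel_K g))"
    by (simp add: V_def sublevel_K_def[symmetric] K_fin)
  have V_pos: "V c = ennreal (measure lborel (sublevel_K g) * c powr (CARD('n) / t))" if "c > 0" for c
  proof -
    \<comment> \<open>With this \<open>r\<close>, the level \<open>c\<close> is
      \<open>r ^ t * 1\<close>, so \<open>V_scale\<close> compares it with
      \<open>V 1\<close>.\<close>
    define r where "r = c powr (1 / t)"
    have r: "r > 0" "r ^ t = c" "r ^ CARD('n) = c powr (CARD('n) / t)"
      using that t by (auto simp: r_def powr_powr powr_realpow[symmetric])
    then show ?thesis
      using V_scale[OF r(1), of 1] by (simp add: V_1 ennreal_mult'[symmetric] mult.commute)
  qed
  \<comment> \<open>The zero set of \<open>g\<close> is invariant under scaling and has finite volume.\<close>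
  have V_0: "V 0 = 0"
  proof -
    have "V 0 \<le> V 1" unfolding V_def by (intro emeasure_mono) auto
    then obtain y where y: "V 0 = ennreal y" "y \<ge> 0"
      unfolding V_1 by (cases "V 0") (auto simp: top_unique)
    then have "y = 2 ^ CARD('n) * y"
      using V_scale[of 2 0] by (simp add: ennreal_mult'[symmetric])
    moreover have "(2::real) ^ CARD('n) > 1" by simp
    ultimately show ?thesis using y by (auto simp: mult_cancel_right1)
  qed
  \<comment> \<open>Level 0 fits the same formula because \<open>0 powr x = 0\<close> matches
    \<open>V_0\<close>.\<close>
  have V: "V c = ennreal (measure lborel (sublevel_K g) * c powr (CARD('n) / t))" if "c \<ge> 0" for c
    using that V_pos[of c] V_0 by (cases "c = 0") auto
  have "emeasure (phi_star g) {..x}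
      = emeasure lborel (box_B \<inter> poly_eval g -` ({..x} \<inter> {0..1})) / ennreal (2 ^ CARD('n))"
    by (simp add: emeasure_phi_star emeasure_push)
  \<comment> \<open>Levels are at most 1, so the sublevel set lies in K and hence in the box;
    nonnegativity of \<open>g\<close> absorbs the lower endpoint 0.\<close>
  also have "box_B \<inter> poly_eval g -` ({..x} \<inter> {0..1}) = {y. poly_eval g y \<le> min x 1}"
    using sub nonneg by (auto simp: sublevel_K_def)
  also have "emeasure lborel \<dots> = (if x < 0 then 0 else
      ennreal (measure lborel (sublevel_K g) * min x 1 powr (CARD('n) / t)))"
  proof (cases "x < 0")
    case True
    then have "{y. poly_eval g y \<le> min x 1} = {}" using nonneg by (auto simp: not_le intro: less_le_trans)
    then show ?thesis using True by simp
  qed (use V[of "min x 1"] in \<open>simp add: V_def\<close>)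
  finally show ?thesis
    by (simp add: divide_ennreal)
qed

section \<open>Identification of \<open>phi_star\<close> with a multiple of a power law, and passage
  to the limit\<close>

theorem theorem3p2:
  fixes g :: "'n::finite rpoly" and t :: nat
  assumes "t \<ge> 2" and "even t"
    and "homogeneous_of_degree t g"
    and "\<forall>x. poly_eval g x \<ge> 0"
    and "sublevel_K g \<subseteq> box_B"
    and "frontier (sublevel_K g) \<subseteq> {x. poly_eval g x = 1}"
  shows "measure (phi_star g) {0..1} = measure lborel (sublevel_K g) / 2 ^ CARD('n) \<and>
    (\<lambda>d. lambda_min (moment_matrix d (push g)) (M_star CARD('n) t d))
      \<longlonglongrightarrow> measure (phi_star g) {0..1}"
proof -
  define a where "a = CARD('n) / t"
  define c where "c = measure lborel (sublevel_K g) / 2 ^ CARD('n)"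
  have a: "a > 0" and c: "c \<ge> 0"
    using assms(1) by (auto simp: a_def c_def)
  have phi_atMost: "emeasure (phi_star g) {..x} = (if x < 0 then 0 else ennreal (c * min x 1 powr a))" for x
    unfolding a_def c_def using assms by (intro emeasure_phi_star_atMost) auto
  have phi_0_1: "measure (phi_star g) {0..1} = c"
  proof -
    \<comment> \<open>Since \<open>phi_star\<close> lives on [0,1], the mass of that interval can be
      read off the distribution function at 1.\<close>
    have "emeasure (phi_star g) {0..1} = emeasure (phi_star g) {..1}"
      by (simp add: emeasure_phi_star Int_absorb1 Int_absorb2)
    then show ?thesis
      using c by (simp add: phi_atMost measure_def)
  qed
  have sets_phi: "sets (phi_star g) = sets borel"
    by (simp add: phi_star_def)
  have phi_fin: "finite_measure (phi_star g)"
  proof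
    have "emeasure (phi_star g) UNIV = emeasure (phi_star g) {..1}"
      by (simp add: emeasure_phi_star Int_absorb1)
    then show "emeasure (phi_star g) (space (phi_star g)) \<noteq> \<infinity>"
      using sets_eq_imp_space_eq[OF sets_phi] by (simp add: phi_atMost)
  qed
  interpret P: finite_measure "power_law a" by (rule finite_measure_power_law[OF a])
  let ?N = "density (power_law a) (\<lambda>_. ennreal c)"
  have N: "emeasure ?N X = ennreal c * emeasure (power_law a) X" if "X \<in> sets borel" for X
    using that by (simp add: emeasure_density_const)
  \<comment> \<open>Both are finite Borel measures with the same distribution function, which
    determines them.\<close>
  have "phi_star g = ?N"
  proof (rule cdf_unique')
    show "finite_borel_measure (phi_star g)"
      using phi_fin sets_phi by (simp add: finite_borel_measure_def finite_borel_measure_axioms_def)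
    have "finite_measure ?N"
      by standard (simp add: N ennreal_mult_eq_top_iff)
    then show "finite_borel_measure ?N"
      by (simp add: finite_borel_measure_def finite_borel_measure_axioms_def)
    have "emeasure (phi_star g) {..x} = emeasure ?N {..x}" for x
      using c by (simp add: N phi_atMost emeasure_power_law_atMost[OF a] ennreal_mult')
    then show "cdf (phi_star g) = cdf ?N"
      by (simp add: cdf_def measure_def fun_eq_iff)
  qed
  then have restr: "density (push g) (indicator {0..1}) = ?N"
    by (simp add: phi_star_def)
  have M_star_eq: "M_star CARD('n) t d = moment_matrix d (power_law a)" for d
  proof -
    have "a / (a + k) = CARD('n) / (CARD('n) + k * t)" for k :: real
      using assms(1) by (simp add: a_def field_simps)
    then show ?thesis
      by (intro eq_matI) (auto simp: M_star_def moment_matrix_def moment_power_law[OF a])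
  qed
  have half: "measure (power_law a) {0..1/2} > 0"
  proof -
    \<comment> \<open>The power law gives no mass to negative numbers, so this is the distribution
      function at 1/2.\<close>
    have "emeasure (power_law a) {0..1/2} = emeasure (power_law a) {..1/2}"
      by (intro emeasure_eq_AE eventually_mono[OF AE_power_law_unit_interval]) auto
    then have "measure (power_law a) {0..1/2} = (1/2) powr a"
      by (simp add: emeasure_power_law_atMost[OF a] measure_def)
    then show ?thesis by simp
  qed
  obtain M where M: "M \<ge> 1" "AE z in push g. z \<in> {0..M}"
    using AE_push_bounded assms(4) by blast
  have "(\<lambda>d. lambda_min (moment_matrix d (push g)) (moment_matrix d (power_law a))) \<longlonglongrightarrow> c"
    by (rule lambda_min_moment_matrices_tendsto[OF finite_measure_push _ P.finite_measure_axioms _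
          M(2,1) AE_power_law_unit_interval AE_power_law_not_in_finite half restr c]) auto
  then show ?thesis
    unfolding phi_0_1 M_star_eq by (simp add: c_def)
qed

end
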